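(* For every constant $c>0$ there is a constant $C>0$ such that the following holds. For every integer $n\ge 1$, every real $\epsilon$ with $0<\epsilon\le c$ and every real $\rho\in(0,1/2]$, there is a non-interactive $\epsilon$-$\mathrm{DP}_{\mathrm{shuffle}}$ protocol for binary summation with $n$ users whose mean squared error on every input dataset is at most $(1+\rho)\cdot\frac{2e^{-\epsilon}}{(1-e^{-\epsilon})^2}$ (i.e., $(1+\rho)$ times the variance of the discrete Laplace distribution with PMF proportional to $e^{-\epsilon|x|}$ on $\mathbb{Z}$), in which each user sends at most $C\cdot\frac{\log(n/\rho)}{\epsilon\rho}$ messages in expectation, and each message consists of a single bit.
   Context: Shuffle model: a non-interactive protocol $P=(R,S,A)$ for $n$ users consists of a randomized local randomizer $R$ that maps a user's input $x_i$ to a finite multiset of messages, a shuffler $S$ that outputs a uniformly random permutation of all messages sent by all users, and an analyst $A$ that maps the shuffler's output to an estimate. Two datasets are neighboring if they differ in exactly one coordinate. The protocol is $\epsilon$-$\mathrm{DP}_{\mathrm{shuffle}}$ if for all neighboring datasets $D=(x_1,\dots,x_n),D'=(x_1',\dots,x_n')$ and every set $T$ of possible shuffler outputs, $\Pr[S(R(x_1),\dots,R(x_n))\in T]\le e^{\epsilon}\Pr[S(R(x_1'),\dots,R(x_n'))\in T]$. Binary summation: each user holds $x_i\in\{0,1\}$ and the goal is to estimate $\sum_i x_i$; the MSE on a dataset is $\mathbb{E}[(\text{output}-\sum_i x_i)^2]$. The discrete Laplace distribution $\mathrm{DLap}(a)$ has PMF proportional to $e^{-a|x|}$ on $\mathbb{Z}$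 and variance $\frac{2e^{-a}}{(1-e^{-a})^2}$. *)

theory Defs
  imports
    "HOL-Probability.Probability"
    "HOL-Combinatorics.Multiset_Permutations"
begin

text \<open>
  A dataset is a list with one entry per user. A protocol is given by a local randomizer
  of type \<open>'x \<Rightarrow> 'm multiset pmf\<close>, used by every user, and an analyst of type
  \<open>'m list \<Rightarrow> real\<close>; the shuffler is fixed. Since the library's multisets are finite and
  \<open>'m multiset\<close> is countable for countable \<open>'m\<close>, using \<open>pmf\<close> loses no generality
  for single-bit messages (\<open>'m = bool\<close>).
\<close>

text \<open>
  The uniform distribution on the distinct arrangements of a multiset is the distribution
  obtained by permuting any enumeration of it by a uniformly random permutation of positions,
  because every arrangement arises from the same number of permutations.
\<close>

definition shuffler :: "'m multiset \<Rightarrow> 'm list pmf" where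
  "shuffler M = pmf_of_set (permutations_of_multiset M)"

definition all_messages :: "('x \<Rightarrow> 'm multiset pmf) \<Rightarrow> 'x list \<Rightarrow> 'm multiset pmf" where
  "all_messages R D =
     map_pmf (\<lambda>f. \<Sum>i<length D. f i) (Pi_pmf {..<length D} {#} (\<lambda>i. R (D ! i)))"

definition shuffled_output :: "('x \<Rightarrow> 'm multiset pmf) \<Rightarrow> 'x list \<Rightarrow> 'm list pmf" where
  "shuffled_output R D = bind_pmf (all_messages R D) shuffler"

definition neighboring :: "'x list \<Rightarrow> 'x list \<Rightarrow> bool" where
  "neighboring D D' \<longleftrightarrow>
     length D = length D' \<and> card {i. i < length D \<and> D ! i \<noteq> D' ! i} = 1"

definition DP_shuffle :: "nat \<Rightarrow> real \<Rightarrow> ('x \<Rightarrow> 'm multiset pmf) \<Rightarrow> bool" where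
  "DP_shuffle n \<epsilon> R \<longleftrightarrow>
     (\<forall>D D'. length D = n \<longrightarrow> length D' = n \<longrightarrow> neighboring D D' \<longrightarrow>
        (\<forall>T. measure_pmf.prob (shuffled_output R D) T
               \<le> exp \<epsilon> * measure_pmf.prob (shuffled_output R D') T))"

text \<open>
  The two expectations below are nonnegative integrals with values in \<open>ennreal\<close>, so that a
  finite upper bound on them includes integrability (a Bochner integral would be \<open>0\<close> for a
  non-integrable function).
\<close>

definition summation_MSE ::
  "(bool \<Rightarrow> 'm multiset pmf) \<Rightarrow> ('m list \<Rightarrow> real) \<Rightarrow> bool list \<Rightarrow> ennreal" where
  "summation_MSE R A D =
     (\<integral>\<^sup>+ y. ennreal ((A y - (\<Sum>x\<leftarrow>D. of_bool x))\<^sup>2) \<partial>measure_pmf (shuffled_output R D))"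

definition expected_messages :: "('x \<Rightarrow> 'm multiset pmf) \<Rightarrow> 'x \<Rightarrow> ennreal" where
  "expected_messages R x = (\<integral>\<^sup>+ M. ennreal (real (size M)) \<partial>measure_pmf (R x))"

end

theory Submission imports Defs begin

text \<open>
  All messages are equal, so only their number is released. Each user sends \<open>g + (m - h) + w\<close>
  messages, where \<open>g\<close> and \<open>h\<close> are independent negative binomials with parameters \<open>1/n\<close> and
  \<open>p = e\<^sup>-\<^sup>\<epsilon>\<close> conditioned to be at most \<open>m\<close>, and \<open>w\<close> encodes the input: \<open>w = m + x\<close> with
  probability \<open>1 - q\<close> and otherwise \<open>w \<in> {0, 2m}\<close> is an unbiased coin flip. Without truncation
  the total of the \<open>g - h\<close> would be exactly discrete Laplace, by infinite divisibility.

  The coefficient recurrence of \<open>(1 - pz)\<^sup>-\<^sup>a\<close> becomes an inequality under truncation and adds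
  the exponents under convolution. For \<open>n\<close> users the exponent is \<open>1\<close>, so the mass function of the
  total of the \<open>g\<close> has ratio exactly \<open>p\<close> up to \<open>m\<close> and at most \<open>p\<close> beyond. A shift by one thus
  costs a factor \<open>e\<^sup>\<epsilon>\<close> up to \<open>m\<close>; beyond \<open>m\<close> the mass is at most \<open>p\<^sup>m\<^sup>-\<^sup>1\<close> times the mass about \<open>m\<close>
  steps earlier, which is where the coin flip moves the total, and so \<open>q\<close> of order \<open>p\<^sup>m/(1 - p)\<close>
  suffices for pure privacy. Truncation only lowers the variance, and \<open>m\<close> of order
  \<open>ln (n/\<rho>)/\<epsilon>\<close> makes the contribution of \<open>q\<close> to the error negligible, unless \<open>n\<close> is so small
  that the constant answer \<open>n/2\<close> is already accurate enough.
\<close>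

section \<open>Sums of independent variables as iterated convolution\<close>

definition conv_pmf :: "'a::comm_monoid_add pmf \<Rightarrow> 'a pmf \<Rightarrow> 'a pmf" where
  "conv_pmf p q = bind_pmf p (\<lambda>x. map_pmf (\<lambda>y. x + y) q)"

lemma conv_pmf_commute: "conv_pmf p q = conv_pmf q p"
  unfolding conv_pmf_def map_pmf_def by (subst bind_commute_pmf) (simp add: add.commute)

lemma conv_pmf_assoc: "conv_pmf (conv_pmf p q) r = conv_pmf p (conv_pmf q r)"
  unfolding conv_pmf_def map_pmf_def by (simp add: bind_assoc_pmf bind_return_pmf add.assoc)

text \<open>This provides \<open>conv.F P A\<close>, the law of a sum of independent draws from
  \<open>P i\<close> over a finite \<open>A\<close>, with the library rules (\<open>insert\<close>,
  \<open>remove\<close>, \<open>distrib\<close>) for regrouping the summands.\<close>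

interpretation conv: comm_monoid_set conv_pmf "return_pmf 0"
proof
  show "conv_pmf (conv_pmf p q) r = conv_pmf p (conv_pmf q r)" for p q r :: "'a pmf"
    by (rule conv_pmf_assoc)
  show "conv_pmf p q = conv_pmf q p" for p q :: "'a pmf"
    by (rule conv_pmf_commute)
  show "conv_pmf p (return_pmf 0) = p" for p :: "'a pmf"
    by (simp add: conv_pmf_def bind_return_pmf')
qed

lemma map_conv_pmf:
  assumes "\<And>x y. f (x + y) = f x + f y"
  shows "map_pmf f (conv_pmf p q) = conv_pmf (map_pmf f p) (map_pmf f q)"
  unfolding conv_pmf_def by (simp add: map_bind_pmf bind_map_pmf pmf.map_comp o_def assms)

lemma map_conv_F:
  assumes "\<And>x y. f (x + y) = f x + f y" "f 0 = 0" "finite A"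
  shows "map_pmf f (conv.F P A) = conv.F (\<lambda>i. map_pmf f (P i)) A"
  using assms(3) by induction (simp_all add: assms(2) map_conv_pmf[OF assms(1)])

text \<open>Bridge from the product distribution in \<open>all_messages\<close> to
  \<open>conv.F\<close>; the model's functions from users to messages disappear here.\<close>

lemma map_sum_Pi_pmf:
  assumes "finite A"
  shows "map_pmf (\<lambda>f. \<Sum>i\<in>A. f i) (Pi_pmf A 0 P) = conv.F P A"
  using assms
proof induction
  case (insert x A)
  have "map_pmf (\<lambda>f. \<Sum>i\<in>insert x A. f i) (Pi_pmf (insert x A) 0 P)
      = map_pmf (\<lambda>(y, f). y + (\<Sum>i\<in>A. f i)) (pair_pmf (P x) (Pi_pmf A 0 P))"
    using insert.hyps
    by (auto simp: Pi_pmf_insert pmf.map_comp o_def intro!: map_pmf_cong sum.cong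
        arg_cong2[of _ _ _ _ "(+)"])
  also have "\<dots> = conv_pmf (P x) (map_pmf (\<lambda>f. \<Sum>i\<in>A. f i) (Pi_pmf A 0 P))"
    by (simp add: conv_pmf_def pair_pmf_def map_pmf_def bind_assoc_pmf bind_return_pmf)
  finally show ?case using insert by simp
qed simp

lemma pmf_map_add_nat:
  "pmf (map_pmf (\<lambda>y. w + y) p) t = (if w \<le> t then pmf p (t - w) else 0)" for w t :: nat
proof (cases "w \<le> t")
  case True
  then have "pmf (map_pmf (\<lambda>y. w + y) p) (w + (t - w)) = pmf p (t - w)"
    by (intro pmf_map_inj') (auto simp: inj_def)
  with True show ?thesis by simp
next
  case False
  then show ?thesis by (auto simp: pmf_eq_0_set_pmf)
qed

lemma pmf_conv_nat:
  "pmf (conv_pmf p q) k = (\<Sum>i\<le>k. pmf p i * pmf q (k - i))" for k :: nat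
proof -
  have "pmf (conv_pmf p q) k = measure_pmf.expectation p (\<lambda>i. if i \<le> k then pmf q (k - i) else 0)"
    by (simp add: conv_pmf_def pmf_bind pmf_map_add_nat)
  also have "\<dots> = (\<Sum>i\<le>k. (if i \<le> k then pmf q (k - i) else 0) * pmf p i)"
    by (rule integral_measure_pmf_real) (auto split: if_splits)
  also have "\<dots> = (\<Sum>i\<le>k. pmf p i * pmf q (k - i))"
    by (intro sum.cong) auto
  finally show ?thesis .
qed

lemma pmf_conv_return_nat:
  "pmf (conv_pmf (return_pmf w) p) t = (if w \<le> t then pmf p (t - w) else 0)" for w t :: nat
  by (simp add: conv_pmf_def bind_return_pmf pmf_map_add_nat)

text \<open>Convolution with a fixed law is linear and monotone, so a pointwise inequality survives
  adding independent noise. The second term on the right carries the contribution of the coin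
  flip.\<close>

lemma pmf_conv_le_nat:
  fixes p p1 p2 q :: "nat pmf" and a b :: real
  assumes "\<And>t. pmf p t \<le> a * pmf p1 t + b * pmf p2 t"
  shows "pmf (conv_pmf p q) t \<le> a * pmf (conv_pmf p1 q) t + b * pmf (conv_pmf p2 q) t"
proof -
  have "pmf (conv_pmf p q) t \<le> (\<Sum>i\<le>t. (a * pmf p1 i + b * pmf p2 i) * pmf q (t - i))"
    unfolding pmf_conv_nat by (intro sum_mono mult_right_mono assms) auto
  also have "\<dots> = a * pmf (conv_pmf p1 q) t + b * pmf (conv_pmf p2 q) t"
    unfolding pmf_conv_nat by (simp add: sum_distrib_left sum.distrib algebra_simps)
  finally show ?thesis .
qed

lemma prob_le_of_pmf_le:
  assumes "\<And>x. pmf p x \<le> c * pmf q x" "c \<ge> 0"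
  shows "measure_pmf.prob p T \<le> c * measure_pmf.prob q T"
proof -
  have "emeasure p T = (\<integral>\<^sup>+x. pmf p x \<partial>count_space T)" by (simp add: nn_integral_pmf)
  also have "\<dots> \<le> (\<integral>\<^sup>+x. ennreal c * pmf q x \<partial>count_space T)"
    by (intro nn_integral_mono) (use assms in \<open>auto simp: ennreal_mult'[symmetric] intro!: ennreal_leI\<close>)
  also have "\<dots> = ennreal c * emeasure q T" by (simp add: nn_integral_cmult nn_integral_pmf)
  finally show ?thesis using assms(2)
    by (simp add: measure_pmf.emeasure_eq_measure ennreal_mult'[symmetric])
qed

section \<open>Truncated negative binomial distributions\<close>

text \<open>
  The recurrence of the coefficients of \<open>(1 - pz)\<^sup>-\<^sup>a\<close>, up to index \<open>m\<close>.
\<close>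
definition nb_rec :: "real \<Rightarrow> nat \<Rightarrow> real \<Rightarrow> nat pmf \<Rightarrow> bool" where
  "nb_rec p m a f \<longleftrightarrow>
     (\<forall>j. real (Suc j) * pmf f (Suc j) \<le> p * (real j + a) * pmf f j) \<and>
     (\<forall>j<m. real (Suc j) * pmf f (Suc j) = p * (real j + a) * pmf f j)"

text \<open>The product rule for generating functions, read off coefficientwise: the factor
  \<open>Suc d\<close> is split as \<open>i + (Suc d - i)\<close> in each term.\<close>

lemma Suc_times_pmf_conv:
  "real (Suc d) * pmf (conv_pmf f g) (Suc d) =
     (\<Sum>i\<le>d. (real (Suc i) * pmf f (Suc i)) * pmf g (d - i)) +
     (\<Sum>i\<le>d. pmf f i * (real (Suc (d - i)) * pmf g (Suc (d - i))))"
proof -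
  have "real (Suc d) * pmf (conv_pmf f g) (Suc d) =
      (\<Sum>i\<le>Suc d. real i * pmf f i * pmf g (Suc d - i)) +
      (\<Sum>i\<le>Suc d. real (Suc d - i) * pmf f i * pmf g (Suc d - i))"
    unfolding pmf_conv_nat sum_distrib_left sum.distrib[symmetric]
    by (intro sum.cong) (auto simp: algebra_simps of_nat_diff)
  also have "(\<Sum>i\<le>Suc d. real i * pmf f i * pmf g (Suc d - i)) =
      (\<Sum>i\<le>d. (real (Suc i) * pmf f (Suc i)) * pmf g (d - i))"
    by (subst sum.atMost_Suc_shift) simp
  also have "(\<Sum>i\<le>Suc d. real (Suc d - i) * pmf f i * pmf g (Suc d - i)) =
      (\<Sum>i\<le>d. pmf f i * (real (Suc (d - i)) * pmf g (Suc (d - i))))"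
    by (auto simp: Suc_diff_le intro!: sum.cong)
  finally show ?thesis .
qed

text \<open>For a generating function F the exact recurrence says (1 - pz) F' = p a F, and
  logarithmic derivatives add under products. The inequality survives since masses are nonnegative;
  for \<open>d < m\<close> the indices \<open>i\<close> and \<open>d - i\<close> are below
  \<open>m\<close> too, so the equality survives as well.\<close>

lemma nb_rec_conv:
  assumes "nb_rec p m a f" "nb_rec p m b g"
  shows "nb_rec p m (a + b) (conv_pmf f g)"
proof -
  have split: "(\<Sum>i\<le>d. (p * (real i + a) * pmf f i) * pmf g (d - i)) +
      (\<Sum>i\<le>d. pmf f i * (p * (real (d - i) + b) * pmf g (d - i))) =
      p * (real d + (a + b)) * pmf (conv_pmf f g) d" for d
    unfolding pmf_conv_nat sum_distrib_left sum.distrib[symmetric]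
    by (intro sum.cong) (auto simp: algebra_simps of_nat_diff)
  show ?thesis
    unfolding nb_rec_def Suc_times_pmf_conv split[symmetric]
    using assms unfolding nb_rec_def
    by (auto intro!: add_mono sum_mono mult_right_mono mult_left_mono
        arg_cong2[of _ _ _ _ "(+)"] sum.cong simp del: of_nat_Suc of_nat_diff)
qed

lemma nb_rec_F:
  assumes "nb_rec p m a f" "finite A"
  shows "nb_rec p m (real (card A) * a) (conv.F (\<lambda>_. f) A)"
  using assms(2)
proof induction
  case empty
  show ?case by (auto simp: nb_rec_def indicator_def)
next
  case (insert x A)
  then show ?case using nb_rec_conv[OF assms(1), of "real (card A) * a" "conv.F (\<lambda>_. f) A"]
    by (simp add: algebra_simps)
qed

text \<open>Solve the recurrence up to \<open>m\<close>, put 0 beyond and normalise. Equality can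
  fail only at \<open>j = m\<close>, where the left side drops to 0, in the direction that
  \<open>nb_rec\<close> permits.\<close>

lemma nb_rec_exists:
  fixes p a :: real and m :: nat
  assumes "0 \<le> p" "0 \<le> a"
  obtains f where "nb_rec p m a f" "set_pmf f \<subseteq> {..m}"
proof -
  define c where "c j = (if j \<le> m then \<Prod>i<j. p * (real i + a) / real (Suc i) else 0)" for j
  have c0: "c j \<ge> 0" for j
    using assms by (auto simp: c_def intro!: prod_nonneg divide_nonneg_nonneg mult_nonneg_nonneg)
  define s where "s = (\<Sum>j\<le>m. c j)"
  have "c 0 \<le> s" unfolding s_def by (rule member_le_sum) (use c0 in auto)
  then have s: "s > 0" by (simp add: c_def)
  define f where "f = embed_pmf (\<lambda>j. c j / s)"
  have "(\<integral>\<^sup>+j. ennreal (c j / s) \<partial>count_space UNIV) = (\<Sum>j\<le>m. ennreal (c j / s))"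
    by (rule nn_integral_count_space') (auto simp: c_def)
  also have "\<dots> = ennreal (\<Sum>j\<le>m. c j / s)"
    by (rule sum_ennreal) (use c0 s in auto)
  also have "(\<Sum>j\<le>m. c j / s) = 1"
    using s by (simp add: s_def sum_divide_distrib[symmetric])
  finally have f: "pmf f j = c j / s" for j
    unfolding f_def using c0 s by (subst pmf_embed_pmf) auto
  have *: "real (Suc j) * c (Suc j) = (if j < m then p * (real j + a) * c j else 0)" for j
    by (auto simp: c_def field_simps simp del: of_nat_Suc)
  have "nb_rec p m a f"
    unfolding nb_rec_def f times_divide_eq_right
    using s assms c0 by (auto simp: * intro!: divide_right_mono simp del: of_nat_Suc)
  moreover have "set_pmf f \<subseteq> {..m}"
    by (auto simp: set_pmf_eq f c_def)
  ultimately show thesis by (rule that)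
qed

section \<open>Mean and variance of finitely supported sums\<close>

lemma expectation_conv_pmf:
  fixes \<phi> :: "'a::comm_monoid_add \<Rightarrow> real"
  assumes "finite (set_pmf p)" "finite (set_pmf q)"
  shows "measure_pmf.expectation (conv_pmf p q) \<phi> =
    measure_pmf.expectation p (\<lambda>x. measure_pmf.expectation q (\<lambda>y. \<phi> (x + y)))"
  unfolding conv_pmf_def
  by (subst pmf_expectation_bind[OF assms(1)]) (use assms in \<open>auto simp: integral_measure_pmf[OF assms(1)]\<close>)

lemma finite_set_conv_pmf:
  "finite (set_pmf p) \<Longrightarrow> finite (set_pmf q) \<Longrightarrow> finite (set_pmf (conv_pmf p q))"
  by (simp add: conv_pmf_def)

abbreviation mean_pmf :: "nat pmf \<Rightarrow> real" where
  "mean_pmf p \<equiv> measure_pmf.expectation p real"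

abbreviation var_pmf :: "nat pmf \<Rightarrow> real" where
  "var_pmf p \<equiv> measure_pmf.variance p real"

lemma mean_conv_pmf:
  assumes "finite (set_pmf p)" "finite (set_pmf q)"
  shows "mean_pmf (conv_pmf p q) = mean_pmf p + mean_pmf q"
  using assms by (simp add: expectation_conv_pmf integrable_measure_pmf_finite)

lemma var_conv_pmf:
  assumes "finite (set_pmf p)" "finite (set_pmf q)"
  shows "var_pmf (conv_pmf p q) = var_pmf p + var_pmf q"
proof -
  note [simp] = integrable_measure_pmf_finite[OF assms(1)] integrable_measure_pmf_finite[OF assms(2)]
  define u v where "u = mean_pmf p" and "v = mean_pmf q"
  have "(\<lambda>x y. (real (x + y) - (u + v))\<^sup>2) =
      (\<lambda>x y. (real x - u)\<^sup>2 + 2 * (real x - u) * (real y - v) + (real y - v)\<^sup>2)"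
    by (auto simp: power2_eq_square algebra_simps)
  then have sq: "(real (x + y) - (u + v))\<^sup>2 =
      (real x - u)\<^sup>2 + 2 * (real x - u) * (real y - v) + (real y - v)\<^sup>2" for x y
    by metis
  have "measure_pmf.expectation q (\<lambda>y. real y - v) = 0"
    by (simp add: v_def)
  then show ?thesis
    unfolding mean_conv_pmf[OF assms] u_def[symmetric] v_def[symmetric]
    by (simp add: expectation_conv_pmf[OF assms] sq del: of_nat_add)
qed

lemma moments_conv_F:
  assumes "finite A" "\<And>i. i \<in> A \<Longrightarrow> finite (set_pmf (P i))"
  shows "finite (set_pmf (conv.F P A)) \<and>
    mean_pmf (conv.F P A) = (\<Sum>i\<in>A. mean_pmf (P i)) \<and>
    var_pmf (conv.F P A) = (\<Sum>i\<in>A. var_pmf (P i))"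
  using assms
proof induction
  case (insert x A)
  then have IH: "finite (set_pmf (conv.F P A))"
      "mean_pmf (conv.F P A) = (\<Sum>i\<in>A. mean_pmf (P i))"
      "var_pmf (conv.F P A) = (\<Sum>i\<in>A. var_pmf (P i))"
    and x: "finite (set_pmf (P x))" by auto
  show ?case
    unfolding conv.insert[OF insert.hyps] sum.insert[OF insert.hyps]
    using finite_set_conv_pmf[OF x IH(1)] mean_conv_pmf[OF x IH(1)] IH(2)
      var_conv_pmf[OF x IH(1)] IH(3) by (intro conjI; linarith)
qed simp

text \<open>The bias-variance decomposition. It serves the error of the estimator, the variance of
  the coin flip and, with \<open>t = 0\<close>, the variance of the noise.\<close>

lemma expectation_square_dist:
  fixes X :: "'a \<Rightarrow> real"
  assumes "finite (set_pmf p)"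
  shows "measure_pmf.expectation p (\<lambda>x. (X x - t)\<^sup>2) =
    measure_pmf.variance p X + (measure_pmf.expectation p X - t)\<^sup>2"
proof -
  note [simp] = integrable_measure_pmf_finite[OF assms]
  define u where "u = measure_pmf.expectation p X"
  have "(\<lambda>x. (X x - t)\<^sup>2) = (\<lambda>x. (X x - u)\<^sup>2 + (2 * (u - t) * (X x - u) + (u - t)\<^sup>2))"
    by (auto simp: power2_eq_square algebra_simps)
  then show ?thesis unfolding u_def[symmetric] by simp (simp add: u_def)
qed

text \<open>The bound is the variance of the untruncated law. Summing the recurrence gives linear
  equations for the first two moments with a boundary term at \<open>m\<close>; in the variance this
  term appears only with a negative sign, by \<open>a \<le> 1\<close>.\<close>

lemma var_nb_rec_le:
  assumes f: "nb_rec p m a f" "set_pmf f \<subseteq> {..m}"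
    and p: "0 < p" "p < 1" and a: "0 \<le> a" "a \<le> 1"
  shows "var_pmf f \<le> p * a / (1 - p)\<^sup>2"
proof -
  have fin: "finite (set_pmf f)" using f(2) finite_subset by blast
  have E: "measure_pmf.expectation f g = (\<Sum>j\<le>m. g j * pmf f j)" for g :: "nat \<Rightarrow> real"
    by (rule integral_measure_pmf_real) (use f(2) in auto)
  have rec: "real (Suc j) * pmf f (Suc j) = p * (real j + a) * pmf f j" if "j < m" for j
    using f(1) that by (auto simp: nb_rec_def)
  define S1 where "S1 = mean_pmf f"
  define S2 where "S2 = measure_pmf.expectation f (\<lambda>j. (real j)\<^sup>2)"
  define t where "t = p * (real m + a) * pmf f m"
  define u where "u = 1 - p"
  have S0: "(\<Sum>j\<le>m. pmf f j) = 1" using f(2) by (intro sum_pmf_eq_1) auto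
  \<comment> \<open>Summation of the recurrence against a weight \<open>g\<close>: the constant 1
    yields the equation for the mean, the identity the one for the second moment.\<close>
  have shift: "(\<Sum>j\<le>m. g j * (real j * pmf f j)) =
      (\<Sum>j\<le>m. g (Suc j) * (p * (real j + a) * pmf f j)) - g (Suc m) * t" for g :: "nat \<Rightarrow> real"
  proof -
    have "(\<Sum>j\<le>m. g j * (real j * pmf f j)) = (\<Sum>j<Suc m. g j * (real j * pmf f j))"
      by (simp only: lessThan_Suc_atMost)
    also have "\<dots> = (\<Sum>j<m. g (Suc j) * (real (Suc j) * pmf f (Suc j)))"
      by (subst sum.lessThan_Suc_shift) simp
    also have "\<dots> = (\<Sum>j<m. g (Suc j) * (p * (real j + a) * pmf f j))"
      by (intro sum.cong) (simp_all add: rec del: of_nat_Suc)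
    also have "\<dots> = (\<Sum>j<Suc m. g (Suc j) * (p * (real j + a) * pmf f j)) - g (Suc m) * t"
      by (simp add: t_def)
    finally show ?thesis by (simp only: lessThan_Suc_atMost)
  qed
  have 1: "S1 = p * (S1 + a) - t"
  proof -
    have "S1 = (\<Sum>j\<le>m. p * (real j + a) * pmf f j) - t"
      using shift[of "\<lambda>_. 1"] by (simp add: S1_def E)
    also have "(\<Sum>j\<le>m. p * (real j + a) * pmf f j) = p * (S1 + a * (\<Sum>j\<le>m. pmf f j))"
      by (simp add: S1_def E sum_distrib_left sum.distrib[symmetric] algebra_simps)
    finally show ?thesis by (simp add: S0)
  qed
  have 2: "S2 = p * (S2 + (1 + a) * S1 + a) - (real m + 1) * t"
  proof -
    have "S2 = (\<Sum>j\<le>m. real j * (real j * pmf f j))"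
      by (simp add: S2_def E power2_eq_square mult.assoc)
    also have "\<dots> = (\<Sum>j\<le>m. real (Suc j) * (p * (real j + a) * pmf f j)) - real (Suc m) * t"
      by (rule shift)
    also have "(\<Sum>j\<le>m. real (Suc j) * (p * (real j + a) * pmf f j)) =
        p * (S2 + (1 + a) * S1 + a * (\<Sum>j\<le>m. pmf f j))"
      by (simp add: S1_def S2_def E sum_distrib_left sum.distrib[symmetric] algebra_simps power2_eq_square)
    finally show ?thesis by (simp add: S0 algebra_simps)
  qed
  have var: "var_pmf f = S2 - S1\<^sup>2"
    using expectation_square_dist[OF fin, of real 0] by (simp add: S1_def S2_def)
  have "u\<^sup>2 * (S2 - S1\<^sup>2) = p * a - t * (p * (1 - a) + u * (real m + 1)) - t\<^sup>2"
  proof -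
    have s1: "u * S1 = p * a - t" using 1 by (simp add: u_def algebra_simps)
    have s2: "u * S2 = p * (1 + a) * S1 + p * a - (real m + 1) * t"
      using 2 by (simp add: u_def algebra_simps)
    have "u\<^sup>2 * (S2 - S1\<^sup>2) = u * (u * S2) - (u * S1)\<^sup>2"
      by (simp add: power2_eq_square algebra_simps)
    also have "\<dots> = p * (1 + a) * (u * S1) + u * (p * a - (real m + 1) * t) - (u * S1)\<^sup>2"
      unfolding s2 by (simp add: algebra_simps)
    also have "\<dots> = p * a - t * (p * (1 - a) + u * (real m + 1)) - t\<^sup>2"
      unfolding s1 by (simp add: u_def power2_eq_square algebra_simps)
    finally show ?thesis .
  qed
  moreover have "t * (p * (1 - a) + u * (real m + 1)) \<ge> 0"
    using p a by (simp add: t_def u_def)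
  moreover have "t\<^sup>2 \<ge> 0" by simp
  ultimately have "u\<^sup>2 * var_pmf f \<le> p * a" unfolding var by linarith
  then show ?thesis using p by (simp add: u_def field_simps)
qed

section \<open>Reflected noise and shifts by one\<close>

text \<open>A variant of \<open>map_conv_pmf\<close> that asks for additivity on the supports only,
  because subtraction on the naturals is additive only while it does not cut off.\<close>

lemma conv_pmf_map:
  assumes "\<And>x y. x \<in> set_pmf p \<Longrightarrow> y \<in> set_pmf q \<Longrightarrow> f x + g y = h (x + y)"
  shows "conv_pmf (map_pmf f p) (map_pmf g q) = map_pmf h (conv_pmf p q)"
  unfolding conv_pmf_def map_bind_pmf bind_map_pmf pmf.map_comp
  using assms by (intro bind_pmf_cong map_pmf_cong) auto

text \<open>Message counts cannot be negative, so a share \<open>h\<close> is subtracted as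
  \<open>m - h\<close>. The support bound is part of the induction because it keeps these
  subtractions genuine.\<close>

lemma map_diff_conv_F:
  fixes P :: "'i \<Rightarrow> nat pmf"
  assumes "finite A" "\<And>i. i \<in> A \<Longrightarrow> set_pmf (P i) \<subseteq> {..m}"
  shows "set_pmf (conv.F P A) \<subseteq> {..card A * m} \<and>
    conv.F (\<lambda>i. map_pmf (\<lambda>x. m - x) (P i)) A = map_pmf (\<lambda>x. card A * m - x) (conv.F P A)"
  using assms
proof induction
  case (insert i A)
  then have IH: "set_pmf (conv.F P A) \<subseteq> {..card A * m}"
    and eq: "conv.F (\<lambda>i. map_pmf (\<lambda>x. m - x) (P i)) A = map_pmf (\<lambda>x. card A * m - x) (conv.F P A)"
    and Pi: "set_pmf (P i) \<subseteq> {..m}" by auto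
  have "set_pmf (conv_pmf (P i) (conv.F P A)) \<subseteq> {..m + card A * m}"
    using IH Pi by (auto simp: conv_pmf_def intro!: add_mono)
  moreover have "conv_pmf (map_pmf (\<lambda>x. m - x) (P i)) (map_pmf (\<lambda>x. card A * m - x) (conv.F P A))
      = map_pmf (\<lambda>x. m + card A * m - x) (conv_pmf (P i) (conv.F P A))"
  proof (rule conv_pmf_map)
    fix x y assume "x \<in> set_pmf (P i)" "y \<in> set_pmf (conv.F P A)"
    then have "x \<le> m" "y \<le> card A * m" using IH Pi by blast+
    then show "m - x + (card A * m - y) = m + card A * m - (x + y)" by simp
  qed
  ultimately show ?case using insert.hyps by (simp add: eq)
qed simp

lemma pmf_map_diff:
  fixes p :: "nat pmf"
  assumes "set_pmf p \<subseteq> {..L}"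
  shows "pmf (map_pmf (\<lambda>x. L - x) p) s = (if s \<le> L then pmf p (L - s) else 0)"
proof (cases "s \<le> L")
  case True
  have "pmf (map_pmf (\<lambda>x. L - x) p) (L - (L - s)) = pmf p (L - s)"
  proof (cases "L - s \<in> set_pmf p")
    case True
    then show ?thesis
      using assms diff_diff_cancel by (intro pmf_map_inj inj_onI) (metis atMost_iff in_mono, simp)
  next
    case False
    then have "L - (L - s) \<notin> set_pmf (map_pmf (\<lambda>x. L - x) p)"
      using \<open>s \<le> L\<close> assms by force
    with False show ?thesis by (metis pmf_eq_0_set_pmf)
  qed
  with True show ?thesis by simp
next
  case False
  then show ?thesis by (auto simp: pmf_eq_0_set_pmf)
qed

lemma geometric_decay:
  fixes u :: "nat \<Rightarrow> real"
  assumes "\<And>j. u (Suc j) \<le> p * u j" "0 \<le> p"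
  shows "u (j + s) \<le> p ^ s * u j"
proof (induction s)
  case (Suc s)
  have "u (j + Suc s) \<le> p * u (j + s)" using assms(1)[of "j + s"] by simp
  also have "\<dots> \<le> p * (p ^ s * u j)" by (intro mult_left_mono Suc assms(2))
  finally show ?case by (simp add: mult.assoc)
qed simp

text \<open>At exponent 1 the factor \<open>j + 1\<close> cancels from both sides, which leaves a
  geometric recurrence.\<close>

lemma nb_rec_one:
  assumes "nb_rec p m 1 f"
  shows "pmf f (Suc j) \<le> p * pmf f j" and "j < m \<Longrightarrow> pmf f (Suc j) = p * pmf f j"
proof -
  have "real (Suc j) * pmf f (Suc j) \<le> real (Suc j) * (p * pmf f j)"
    using assms unfolding nb_rec_def by (simp add: algebra_simps)
  then show "pmf f (Suc j) \<le> p * pmf f j"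
    by (rule mult_left_le_imp_le) simp
next
  assume "j < m"
  then have "real (Suc j) * pmf f (Suc j) = real (Suc j) * (p * pmf f j)"
    using assms unfolding nb_rec_def by (simp add: algebra_simps)
  then show "pmf f (Suc j) = p * pmf f j"
    by (subst (asm) mult_cancel_left) simp
qed

text \<open>Below index \<open>m\<close> the unit shift costs exactly \<open>1 / p\<close>. From
  \<open>m\<close> on the next mass may be too small, even 0, so the tail is charged to the coin
  outcome \<open>2 * m\<close> instead.\<close>

lemma nb_shift_up:
  assumes f: "nb_rec p m 1 f" and p: "0 < p" and m: "m \<ge> 1"
  shows "pmf (conv_pmf (return_pmf (m + 1)) f) t \<le>
    1 / p * pmf (conv_pmf (return_pmf m) f) t +
    p ^ (m - 1) * pmf (conv_pmf (return_pmf (2 * m)) f) t"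
proof (cases "m + 1 \<le> t")
  case False
  then show ?thesis using p by (simp add: pmf_conv_return_nat)
next
  case True
  define s where "s = t - (m + 1)"
  have t: "t = s + m + 1" using True by (simp add: s_def)
  show ?thesis
  proof (cases "s < m")
    case True
    have "pmf f s = 1 / p * pmf f (Suc s)" using nb_rec_one(2)[OF f True] p by simp
    then show ?thesis using p by (simp add: pmf_conv_return_nat t)
  next
    case False
    \<comment> \<open>The shift \<open>2 * m\<close> reads \<open>f\<close> at
      \<open>t - 2 * m = s + 1 - m\<close>, which lies \<open>m - 1\<close> steps before
      \<open>s\<close>; hence the exponent.\<close>
    have "pmf f (s + 1 - m + (m - 1)) \<le> p ^ (m - 1) * pmf f (s + 1 - m)"
      by (rule geometric_decay) (use nb_rec_one(1)[OF f] p in auto)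
    moreover have "s + 1 - m + (m - 1) = s" "t - 2 * m = s + 1 - m"
      using False m by (auto simp: t)
    ultimately show ?thesis using p False
      by (simp add: pmf_conv_return_nat t add_increasing)
  qed
qed

text \<open>The mirror image of \<open>nb_shift_up\<close>: for the reflected noise the ratio
  \<open>p\<close> runs the other way, and the coin outcome 0 absorbs the tail.\<close>

lemma nb_shift_down:
  assumes f: "nb_rec p m 1 f" "set_pmf f \<subseteq> {..L}" and p: "0 < p" "p \<le> 1" and m: "m \<le> L"
  defines "g \<equiv> map_pmf (\<lambda>x. L - x) f"
  shows "pmf (conv_pmf (return_pmf m) g) t \<le>
    1 / p * pmf (conv_pmf (return_pmf (m + 1)) g) t +
    p ^ (m - 1) * pmf (conv_pmf (return_pmf 0) g) t"
proof (cases "m \<le> t \<and> t \<le> m + L")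
  case False
  then show ?thesis using p f(2) by (auto simp: pmf_conv_return_nat g_def pmf_map_diff)
next
  case True
  define d where "d = L - (t - m)"
  have t: "t = m + L - d" and d: "d \<le> L" using True by (auto simp: d_def)
  show ?thesis
  proof (cases "d < m")
    case True
    have "pmf f d = 1 / p * pmf f (Suc d)" using nb_rec_one(2)[OF f(1) True] p by simp
    moreover have "L - (L - Suc d) = Suc d" using True m by auto
    ultimately show ?thesis using True m p f(2)
      by (simp add: pmf_conv_return_nat g_def pmf_map_diff t Suc_le_eq)
  next
    case False
    \<comment> \<open>The shift 0 reads \<open>f\<close> at \<open>d - m\<close>, a full
      \<open>m\<close> steps back. The exponent is weakened to \<open>m - 1\<close> so that both
      directions share one constant \<open>K\<close> in \<open>blanket_pmf_le\<close>.\<close>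
    have "pmf f (d - m + m) \<le> p ^ m * pmf f (d - m)"
      by (rule geometric_decay) (use nb_rec_one(1)[OF f(1)] p in auto)
    also have "\<dots> \<le> p ^ (m - 1) * pmf f (d - m)"
      using p by (intro mult_right_mono power_decreasing) auto
    finally show ?thesis using False d p f(2)
      by (simp add: pmf_conv_return_nat g_def pmf_map_diff t add_increasing)
  qed
qed

section \<open>Hiding one input behind a coin flip\<close>

text \<open>The offset \<open>m\<close> leaves room for a jump of about \<open>m\<close> downwards
  without negative counts. The two coin outcomes average to \<open>m\<close>, so the mean is
  \<open>m + (1 - q) * x\<close> and the offset can be subtracted exactly.\<close>

definition blanket_pmf :: "real \<Rightarrow> nat \<Rightarrow> nat \<Rightarrow> nat pmf" where
  "blanket_pmf q m x = bind_pmf (bernoulli_pmf q) (\<lambda>b.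
     if b then map_pmf (\<lambda>c. if c then 0 else 2 * m) (bernoulli_pmf (1 / 2))
     else return_pmf (m + x))"

lemma pmf_conv_blanket:
  assumes "0 \<le> q" "q \<le> 1"
  shows "pmf (conv_pmf (blanket_pmf q m x) f) t =
    (1 - q) * pmf (conv_pmf (return_pmf (m + x)) f) t +
    q / 2 * (pmf (conv_pmf (return_pmf 0) f) t + pmf (conv_pmf (return_pmf (2 * m)) f) t)"
  using assms
  by (simp add: conv_pmf_def blanket_pmf_def bind_assoc_pmf bind_map_pmf bind_return_pmf
      pmf_bind if_distrib[of "\<lambda>u. bind_pmf u _"] if_distrib[of "\<lambda>u. pmf u _"] field_simps
      cong: if_cong)

lemma expectation_blanket:
  fixes g :: "nat \<Rightarrow> real"
  assumes "0 \<le> q" "q \<le> 1"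
  shows "measure_pmf.expectation (blanket_pmf q m x) g =
    (1 - q) * g (m + x) + q / 2 * (g 0 + g (2 * m))"
  unfolding blanket_pmf_def using assms
  by (subst pmf_expectation_bind[of UNIV]) (auto simp: UNIV_bool field_simps)

text \<open>The coin flip has the same law for \<open>x\<close> and \<open>y\<close>, so multiplying
  it by \<open>r\<close> leaves a slack of \<open>(r - 1) * q / 2\<close> times the masses at shifts
  0 and \<open>2 * m\<close>. The condition on \<open>q\<close> makes this slack cover the additive
  terms of \<open>up\<close> and \<open>down\<close>.\<close>

lemma blanket_pmf_le:
  fixes f :: "nat pmf"
  assumes q: "0 \<le> q" "q \<le> 1" "2 * (1 - q) * K \<le> (r - 1) * q" and K: "K \<ge> 0" and r: "r \<ge> 1"
    and up: "\<And>t. pmf (conv_pmf (return_pmf (m + 1)) f) t \<le>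
      r * pmf (conv_pmf (return_pmf m) f) t + K * pmf (conv_pmf (return_pmf (2 * m)) f) t"
    and down: "\<And>t. pmf (conv_pmf (return_pmf m) f) t \<le>
      r * pmf (conv_pmf (return_pmf (m + 1)) f) t + K * pmf (conv_pmf (return_pmf 0) f) t"
    and xy: "x \<le> 1" "y \<le> 1"
  shows "pmf (conv_pmf (blanket_pmf q m x) f) t \<le> r * pmf (conv_pmf (blanket_pmf q m y) f) t"
proof -
  define S where "S w = pmf (conv_pmf (return_pmf w) f) t" for w
  have S: "S w \<ge> 0" for w by (simp add: S_def)
  have main: "(1 - q) * u + q / 2 * (S 0 + S (2 * m)) \<le>
      r * ((1 - q) * v + q / 2 * (S 0 + S (2 * m)))"
    if "u \<le> r * v + K * (S 0 + S (2 * m))" for u v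
  proof -
    have "(1 - q) * u \<le> (1 - q) * (r * v + K * (S 0 + S (2 * m)))"
      by (intro mult_left_mono that) (use q in auto)
    moreover have "(2 * (1 - q) * K) * (S 0 + S (2 * m)) \<le> ((r - 1) * q) * (S 0 + S (2 * m))"
      by (intro mult_right_mono q) (use S in auto)
    ultimately show ?thesis by (simp add: algebra_simps)
  qed
  have KS: "K * S 0 \<ge> 0" "K * S (2 * m) \<ge> 0" using K S by auto
  have self: "S w \<le> r * S w + K * (S 0 + S (2 * m))" for w
  proof -
    have "1 * S w \<le> r * S w" by (intro mult_right_mono r S)
    then show ?thesis using KS by (simp add: algebra_simps)
  qed
  have "S (m + x) \<le> r * S (m + y) + K * (S 0 + S (2 * m))"
  proof -
    have *: "S (m + 1) \<le> r * S m + K * (S 0 + S (2 * m))" "S m \<le> r * S (m + 1) + K * (S 0 + S (2 * m))"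
      using up[of t] down[of t] KS by (auto simp: S_def algebra_simps)
    have "x = 0 \<or> x = 1" "y = 0 \<or> y = 1" using xy by auto
    then show ?thesis using * self[of m] self[of "m + 1"] by auto
  qed
  then show ?thesis
    unfolding pmf_conv_blanket[OF q(1,2)] S_def[symmetric] by (rule main)
qed

section \<open>Protocols that reveal only a message count\<close>

lemma replicate_mset_add: "replicate_mset (a + b) x = replicate_mset a x + replicate_mset b x"
  by (induction a) auto

definition unary :: "('x \<Rightarrow> nat pmf) \<Rightarrow> 'x \<Rightarrow> bool multiset pmf" where
  "unary U x = map_pmf (\<lambda>k. replicate_mset k True) (U x)"

text \<open>Equal messages have a single arrangement, so the shuffler's output carries exactly the
  total count.\<close>

lemma shuffled_output_unary:
  "shuffled_output (unary U) D =
     map_pmf (\<lambda>k. replicate k True) (conv.F (\<lambda>i. U (D ! i)) {..<length D})"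
proof -
  have "all_messages (unary U) D =
      map_pmf (\<lambda>k. replicate_mset k True) (conv.F (\<lambda>i. U (D ! i)) {..<length D})"
    unfolding all_messages_def
    by (subst map_sum_Pi_pmf[unfolded zero_multiset_def[symmetric]])
       (simp_all add: unary_def map_conv_F replicate_mset_add)
  moreover have "shuffler (replicate_mset k True) = return_pmf (replicate k True)" for k
  proof -
    have "xs = replicate k True" if "mset xs = replicate_mset k True" for xs
      using that by (intro replicate_eqI) (metis size_mset size_replicate_mset,
          metis in_replicate_mset set_mset_mset)
    then have "permutations_of_multiset (replicate_mset k True) = {replicate k True}"
      by (auto simp: permutations_of_multiset_def)
    then show ?thesis by (simp add: shuffler_def pmf_of_set_singleton)
  qed
  ultimately show ?thesis
    by (simp add: shuffled_output_def bind_map_pmf map_pmf_def[of "\<lambda>k. replicate k True"])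
qed

text \<open>All \<open>n\<close> noise shares are pooled with the input of the one user who changes;
  the other users' inputs form an independent summand \<open>Q\<close> common to both datasets.
  Privacy thus reduces to one input plus the total noise.\<close>

lemma DP_shuffle_unary:
  fixes Y :: "nat pmf" and W :: "'x \<Rightarrow> nat pmf"
  assumes "\<And>x y t. pmf (conv_pmf (W x) (conv.F (\<lambda>_. Y) {..<n})) t \<le>
      exp \<epsilon> * pmf (conv_pmf (W y) (conv.F (\<lambda>_. Y) {..<n})) t"
  shows "DP_shuffle n \<epsilon> (unary (\<lambda>x. conv_pmf Y (W x)))"
  unfolding DP_shuffle_def
proof (intro allI impI)
  fix D D' :: "'x list" and T
  assume len: "length D = n" "length D' = n" and "neighboring D D'"
  then have "card {i. i < n \<and> D ! i \<noteq> D' ! i} = 1" by (simp add: neighboring_def)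
  then obtain i where i: "{i. i < n \<and> D ! i \<noteq> D' ! i} = {i}" by (rule card_1_singletonE)
  from i have "i < n" by blast
  define N where "N = conv.F (\<lambda>_. Y) {..<n}"
  define Q where "Q = conv.F (\<lambda>j. W (D ! j)) ({..<n} - {i})"
  \<comment> \<open>Stated for every \<open>E\<close> that agrees with \<open>D\<close> away from
    \<open>i\<close>, so that it applies to \<open>D\<close> and \<open>D'\<close> with the same
    \<open>Q\<close>.\<close>
  have eq: "conv.F (\<lambda>j. conv_pmf Y (W (E ! j))) {..<n} = conv_pmf (conv_pmf (W (E ! i)) N) Q"
    if "\<And>j. j < n \<Longrightarrow> j \<noteq> i \<Longrightarrow> E ! j = D ! j" for E
  proof -
    have "conv.F (\<lambda>j. W (E ! j)) {..<n} =
        conv_pmf (W (E ! i)) (conv.F (\<lambda>j. W (E ! j)) ({..<n} - {i}))"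
      using \<open>i < n\<close> by (intro conv.remove) auto
    also have "conv.F (\<lambda>j. W (E ! j)) ({..<n} - {i}) = Q"
      unfolding Q_def by (intro conv.cong) (auto simp: that)
    finally show ?thesis
      unfolding conv.distrib N_def[symmetric] by (metis conv_pmf_assoc conv_pmf_commute)
  qed
  have "D' ! j = D ! j" if "j < n" "j \<noteq> i" for j
  proof (rule ccontr)
    assume "D' ! j \<noteq> D ! j"
    with \<open>j < n\<close> have "j \<in> {i. i < n \<and> D ! i \<noteq> D' ! i}" by simp
    with \<open>j \<noteq> i\<close> show False unfolding i by simp
  qed
  then have D': "conv.F (\<lambda>j. conv_pmf Y (W (D' ! j))) {..<n} = conv_pmf (conv_pmf (W (D' ! i)) N) Q"
    by (intro eq) auto
  have D: "conv.F (\<lambda>j. conv_pmf Y (W (D ! j))) {..<n} = conv_pmf (conv_pmf (W (D ! i)) N) Q"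
    by (intro eq) auto
  have "pmf (conv_pmf (conv_pmf (W (D ! i)) N) Q) t \<le>
      exp \<epsilon> * pmf (conv_pmf (conv_pmf (W (D' ! i)) N) Q) t +
      0 * pmf (conv_pmf (conv_pmf (W (D' ! i)) N) Q) t" for t
    by (rule pmf_conv_le_nat) (use assms in \<open>simp add: N_def\<close>)
  then show "measure_pmf.prob (shuffled_output (unary (\<lambda>x. conv_pmf Y (W x))) D) T
      \<le> exp \<epsilon> * measure_pmf.prob (shuffled_output (unary (\<lambda>x. conv_pmf Y (W x))) D') T"
    unfolding shuffled_output_unary len D D' measure_map_pmf
    by (intro prob_le_of_pmf_le) auto
qed

section \<open>The noisy protocol and the silent protocol\<close>

text \<open>The three terms of the error bound are the discrete Laplace variance, the variance from
  the coin flips and the squared bias.\<close>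

lemma unary_protocol:
  fixes n m :: nat and \<epsilon> :: real
  defines "p \<equiv> exp (- \<epsilon>)"
  defines "q \<equiv> 2 * p ^ m / (1 - p)"
  assumes n: "n \<ge> 1" and m: "m \<ge> 1" and \<epsilon>: "\<epsilon> > 0" and q: "q \<le> 1"
  shows "\<exists>(R :: bool \<Rightarrow> bool multiset pmf) A. DP_shuffle n \<epsilon> R \<and>
    (\<forall>D. length D = n \<longrightarrow> summation_MSE R A D \<le>
       ennreal (2 * p / (1 - p)\<^sup>2 + real n * (q * ((real m)\<^sup>2 + 1)) + (real n * q)\<^sup>2)) \<and>
    (\<forall>x. expected_messages R x \<le> ennreal (4 * real m))"
proof -
  have p: "0 < p" "p < 1" "1 / p = exp \<epsilon>" using \<epsilon> by (auto simp: p_def exp_minus field_simps)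
  have q0: "0 \<le> q" using p by (simp add: q_def)
  define a where "a = 1 / real n"
  have a: "0 \<le> a" "a \<le> 1" "real n * a = 1" using n by (auto simp: a_def)
  obtain G where G: "nb_rec p m a G" "set_pmf G \<subseteq> {..m}"
    using nb_rec_exists[of p a m] p a by auto
  have fG: "finite (set_pmf G)" using G(2) finite_subset by blast
  define G' where "G' = map_pmf (\<lambda>x. m - x) G"
  define Y where "Y = conv_pmf G G'"
  define W where "W b = blanket_pmf q m (of_bool b)" for b
  define N where "N = conv.F (\<lambda>_. Y) {..<n}"
  define A where "A = conv.F (\<lambda>_. G) {..<n}"
  define B where "B = map_pmf (\<lambda>x. n * m - x) A"
  define R where "R = unary (\<lambda>b. conv_pmf Y (W b))"
  \<comment> \<open>Per user, the noise \<open>Y\<close> has mean \<open>m\<close> and the encoded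
    input has offset \<open>m\<close>.\<close>
  define est where "est y = real (length y) - 2 * real n * real m" for y :: "bool list"

  have A: "nb_rec p m 1 A"
    using nb_rec_F[OF G(1), of "{..<n}"] by (simp add: A_def a)
  have A': "set_pmf A \<subseteq> {..n * m}" and B: "conv.F (\<lambda>_. G') {..<n} = B"
    using map_diff_conv_F[of "{..<n}" "\<lambda>_. G" m] G(2) by (auto simp: A_def B_def G'_def)
  have N: "N = conv_pmf A B"
    unfolding N_def Y_def by (simp add: conv.distrib A_def[symmetric] B)
  \<comment> \<open>Both orders of the two noise halves are recorded: \<open>A\<close> pays for the
    upward shift and \<open>B\<close> for the downward one, the other half being added by
    \<open>pmf_conv_le_nat\<close>.\<close>
  then have N': "N = conv_pmf B A" by (simp add: conv_pmf_commute)
  have "m * 1 \<le> m * n" using n by (intro mult_le_mono) auto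
  then have mn: "m \<le> n * m" by (simp add: mult.commute)

  have "DP_shuffle n \<epsilon> R"
    unfolding R_def
  proof (rule DP_shuffle_unary)
    fix x y :: bool and t
    have "pmf (conv_pmf (blanket_pmf q m (of_bool x)) N) t \<le>
        1 / p * pmf (conv_pmf (blanket_pmf q m (of_bool y)) N) t"
    proof (rule blanket_pmf_le[where K = "p ^ (m - 1)"])
      \<comment> \<open>This identity dictates the choice of \<open>q\<close>: it is the condition
        of \<open>blanket_pmf_le\<close> with \<open>1 - q\<close> bounded by 1.\<close>
      have "(1 / p - 1) * q = 2 * p ^ (m - 1)"
        using p m by (cases m) (auto simp: q_def field_simps)
      moreover have "2 * (1 - q) * p ^ (m - 1) \<le> 2 * 1 * p ^ (m - 1)"
        using p q0 by (intro mult_right_mono mult_left_mono) auto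
      ultimately show "2 * (1 - q) * p ^ (m - 1) \<le> (1 / p - 1) * q" by simp
      show "pmf (conv_pmf (return_pmf (m + 1)) N) t \<le>
          1 / p * pmf (conv_pmf (return_pmf m) N) t +
          p ^ (m - 1) * pmf (conv_pmf (return_pmf (2 * m)) N) t" for t
        unfolding N conv_pmf_assoc[symmetric]
        by (intro pmf_conv_le_nat nb_shift_up A p m)
      show "pmf (conv_pmf (return_pmf m) N) t \<le>
          1 / p * pmf (conv_pmf (return_pmf (m + 1)) N) t +
          p ^ (m - 1) * pmf (conv_pmf (return_pmf 0) N) t" for t
        unfolding N' conv_pmf_assoc[symmetric] unfolding B_def
        by (rule pmf_conv_le_nat, rule nb_shift_down[OF A A' _ _ mn]) (use p in auto)
    qed (use p q q0 \<epsilon> in auto)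
    then show "pmf (conv_pmf (W x) (conv.F (\<lambda>_. Y) {..<n})) t \<le>
        exp \<epsilon> * pmf (conv_pmf (W y) (conv.F (\<lambda>_. Y) {..<n})) t"
      by (simp add: W_def N_def p(3))
  qed

  moreover have "summation_MSE R est D \<le>
      ennreal (2 * p / (1 - p)\<^sup>2 + real n * (q * ((real m)\<^sup>2 + 1)) + (real n * q)\<^sup>2)"
    if D: "length D = n" for D
  proof -
    define S where "S = conv.F (\<lambda>i. conv_pmf Y (W (D ! i))) {..<n}"
    define s :: real where "s = (\<Sum>i<n. of_bool (D ! i))"
    have s: "(\<Sum>x\<leftarrow>D. of_bool x) = s"
      using D by (simp add: s_def sum_list_sum_nth lessThan_atLeast0)
    have s_le: "0 \<le> s" "s \<le> real n"
      using sum_bounded_above[of "{..<n}" "\<lambda>i. of_bool (D ! i) :: real" 1]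
      by (auto simp: s_def intro!: sum_nonneg)
    have fG': "finite (set_pmf G')" using fG by (simp add: G'_def)
    have fY: "finite (set_pmf Y)" unfolding Y_def by (rule finite_set_conv_pmf[OF fG fG'])
    have fW: "finite (set_pmf (W b))" for b by (simp add: W_def blanket_pmf_def)
    have int: "integrable (measure_pmf G) f" for f :: "nat \<Rightarrow> real"
      by (rule integrable_measure_pmf_finite[OF fG])
    have real_diff: "real (m - x) = real m - real x" if "x \<in> set_pmf G" for x
      using G(2) that by (auto simp: of_nat_diff)
    have mG': "mean_pmf G' = real m - mean_pmf G"
    proof -
      have "mean_pmf G' = measure_pmf.expectation G (\<lambda>x. real m - real x)"
        unfolding G'_def integral_map_pmf
        by (intro integral_cong_AE) (auto simp: AE_measure_pmf_iff real_diff)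
      then show ?thesis by (simp add: int)
    qed
    have vG': "var_pmf G' = var_pmf G"
    proof -
      have "var_pmf G' = measure_pmf.expectation G (\<lambda>x. (real m - real x - (real m - mean_pmf G))\<^sup>2)"
        unfolding mG' unfolding G'_def integral_map_pmf
        by (intro integral_cong_AE) (auto simp: AE_measure_pmf_iff real_diff)
      then show ?thesis by (simp add: power2_commute)
    qed
    have mY: "mean_pmf Y = real m"
      unfolding Y_def mean_conv_pmf[OF fG fG'] mG' by simp
    have vY: "var_pmf Y \<le> 2 * (p * a / (1 - p)\<^sup>2)"
      unfolding Y_def var_conv_pmf[OF fG fG'] vG'
      using var_nb_rec_le[OF G p(1,2) a(1,2)] by simp
    have mW: "mean_pmf (W b) = real m + (1 - q) * of_bool b" for b
      unfolding W_def expectation_blanket[OF q0 q] by (simp add: field_simps)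
    have vW: "var_pmf (W b) \<le> q * ((real m)\<^sup>2 + 1)" for b
    proof -
      \<comment> \<open>Around \<open>m + b\<close> instead of the mean, only the coin branch
        contributes; the cross terms of its two outcomes cancel.\<close>
      have "var_pmf (W b) \<le> measure_pmf.expectation (W b) (\<lambda>w. (real w - (real m + of_bool b))\<^sup>2)"
        by (subst expectation_square_dist[OF fW, where t = "real m + of_bool b"]) simp
      also have "\<dots> = q * ((real m)\<^sup>2 + of_bool b)"
        unfolding W_def expectation_blanket[OF q0 q]
        by (cases b) (simp_all add: power2_eq_square algebra_simps)
      also have "\<dots> \<le> q * ((real m)\<^sup>2 + 1)" using q0 by (intro mult_left_mono) auto
      finally show ?thesis .
    qed
    have fYW: "finite (set_pmf (conv_pmf Y (W b)))" for b
      by (rule finite_set_conv_pmf[OF fY fW])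
    have S: "finite (set_pmf S)"
        "mean_pmf S = (\<Sum>i<n. mean_pmf (conv_pmf Y (W (D ! i))))"
        "var_pmf S = (\<Sum>i<n. var_pmf (conv_pmf Y (W (D ! i))))"
      using moments_conv_F[of "{..<n}" "\<lambda>i. conv_pmf Y (W (D ! i))"] fYW by (auto simp: S_def)
    have mS: "mean_pmf S = 2 * real n * real m + (1 - q) * s"
      unfolding S(2) mean_conv_pmf[OF fY fW] mY mW s_def sum.distrib sum_distrib_left[symmetric]
      by simp
    have "var_pmf S \<le> (\<Sum>i<n. 2 * (p * a / (1 - p)\<^sup>2) + q * ((real m)\<^sup>2 + 1))"
      unfolding S(3) var_conv_pmf[OF fY fW] by (intro sum_mono add_mono vY vW)
    \<comment> \<open>Since \<open>n * a = 1\<close>, the noise variances of all users add up to one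
      discrete Laplace variance.\<close>
    also have "\<dots> = 2 * (p * (real n * a) / (1 - p)\<^sup>2) + real n * (q * ((real m)\<^sup>2 + 1))"
      by (simp add: algebra_simps)
    finally have vS: "var_pmf S \<le> 2 * p / (1 - p)\<^sup>2 + real n * (q * ((real m)\<^sup>2 + 1))"
      by (simp add: a)
    have "summation_MSE R est D =
        (\<integral>\<^sup>+ k. ennreal ((real k - (2 * real n * real m + s))\<^sup>2) \<partial>measure_pmf S)"
      unfolding summation_MSE_def R_def shuffled_output_unary D S_def[symmetric] s
      by (simp add: est_def diff_diff_eq)
    also have "\<dots> = ennreal (measure_pmf.expectation S (\<lambda>k. (real k - (2 * real n * real m + s))\<^sup>2))"
      by (intro nn_integral_eq_integral integrable_measure_pmf_finite S(1)) simp
    also have "measure_pmf.expectation S (\<lambda>k. (real k - (2 * real n * real m + s))\<^sup>2) =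
        var_pmf S + (q * s)\<^sup>2"
    proof -
      \<comment> \<open>\<open>est\<close> does not rescale by \<open>1 - q\<close>, which leaves
        the bias \<open>- (q * s)\<close>.\<close>
      have "mean_pmf S - (2 * real n * real m + s) = - (q * s)"
        unfolding mS by (simp add: algebra_simps)
      then show ?thesis
        by (subst expectation_square_dist[OF S(1), where t = "2 * real n * real m + s"]) simp
    qed
    also have "ennreal (var_pmf S + (q * s)\<^sup>2) \<le>
        ennreal (2 * p / (1 - p)\<^sup>2 + real n * (q * ((real m)\<^sup>2 + 1)) + (real n * q)\<^sup>2)"
      using q0 s_le by (intro ennreal_leI add_mono vS power_mono) (auto simp: mult.commute intro!: mult_left_mono)
    finally show ?thesis .
  qed

  moreover have "expected_messages R x \<le> ennreal (4 * real m)" for x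
  proof -
    \<comment> \<open>The count is bounded surely: \<open>m\<close> for each noise part and
      \<open>2 * m\<close> for the input, where \<open>m + x \<le> 2 * m\<close> uses
      \<open>m \<ge> 1\<close>.\<close>
    have "k \<le> 4 * m" if *: "k \<in> set_pmf (conv_pmf Y (W x))" for k
    proof -
      obtain g h w where k: "k = g + (m - h) + w" and "g \<in> set_pmf G" and w: "w \<in> set_pmf (W x)"
        using * by (auto simp: conv_pmf_def Y_def G'_def)
      then have "g \<le> m" using G(2) by auto
      moreover have "w \<le> 2 * m"
        using w m by (auto simp: W_def blanket_pmf_def split: if_splits)
      ultimately show ?thesis unfolding k by simp
    qed
    then have "expected_messages R x \<le> (\<integral>\<^sup>+ k. ennreal (4 * real m) \<partial>measure_pmf (conv_pmf Y (W x)))"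
      unfolding expected_messages_def R_def unary_def nn_integral_map_pmf
      by (intro nn_integral_mono_AE) (force simp: AE_measure_pmf_iff intro!: ennreal_leI)
    then show ?thesis by simp
  qed
  ultimately show ?thesis by blast
qed

text \<open>The fallback for small \<open>n\<close>: the true sum lies in [0, n], so the answer
  \<open>n / 2\<close> is off by at most \<open>n / 2\<close>.\<close>

lemma silent_protocol:
  fixes n :: nat and \<epsilon> :: real
  assumes "\<epsilon> \<ge> 0"
  shows "\<exists>(R :: bool \<Rightarrow> bool multiset pmf) A. DP_shuffle n \<epsilon> R \<and>
    (\<forall>D. length D = n \<longrightarrow> summation_MSE R A D \<le> ennreal ((real n)\<^sup>2 / 4)) \<and>
    (\<forall>x. expected_messages R x \<le> 0)"
proof (intro exI conjI allI impI)
  let ?R = "unary (\<lambda>_. return_pmf 0) :: bool \<Rightarrow> bool multiset pmf"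
  have out: "shuffled_output ?R D = return_pmf []" for D
    by (simp add: shuffled_output_unary)
  show "DP_shuffle n \<epsilon> ?R"
    using assms by (auto simp: DP_shuffle_def out indicator_def)
  show "expected_messages ?R x \<le> 0" for x
    by (simp add: expected_messages_def unary_def)
  fix D :: "bool list" assume D: "length D = n"
  define s :: real where "s = (\<Sum>x\<leftarrow>D. of_bool x)"
  have s: "0 \<le> s" "s \<le> real n"
    unfolding s_def D[symmetric] by (induction D) auto
  have "\<bar>real n / 2 - s\<bar> \<le> real n / 2" using s by linarith
  then have "\<bar>real n / 2 - s\<bar>\<^sup>2 \<le> (real n / 2)\<^sup>2" by (rule power_mono) simp
  then show "summation_MSE ?R (\<lambda>_. real n / 2) D \<le> ennreal ((real n)\<^sup>2 / 4)"
    by (auto simp: summation_MSE_def out s_def power_divide intro!: ennreal_leI)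
qed

section \<open>Choice of the truncation point\<close>

text \<open>Half of the exponential decay absorbs the quadratic factor. It is applied at
  \<open>x = \<epsilon> * m\<close>, to the factor \<open>m\<^sup>2\<close> in the variance of the
  coin flips.\<close>

lemma square_times_exp_le:
  fixes x :: real
  assumes "0 \<le> x"
  shows "x\<^sup>2 * exp (- x) \<le> 8 * exp (- (x / 2))"
proof -
  have "x\<^sup>2 / 8 \<le> exp (x / 2)"
    using exp_lower_Taylor_quadratic[of "x / 2"] assms by (simp add: power_divide)
  then have "x\<^sup>2 * exp (- x) \<le> (8 * exp (x / 2)) * exp (- x)"
    by (intro mult_right_mono) auto
  also have "\<dots> = 8 * exp (- (x / 2))" by (simp add: mult.assoc exp_add[symmetric])
  finally show ?thesis .
qed

text \<open>The assumption \<open>large\<close> forces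
  \<open>1 / \<epsilon> \<le> exp c * n\<close>. Powers of \<open>1 / \<epsilon>\<close> in the
  error can thus be traded for powers of \<open>n\<close>, and \<open>m\<close> needs no extra term
  ln (1/\<epsilon>).\<close>

lemma parameter_bounds:
  fixes c \<epsilon> \<rho> :: real and n :: nat
  assumes c: "c > 0" and n: "n \<ge> 1" and \<epsilon>: "0 < \<epsilon>" "\<epsilon> \<le> c" and \<rho>: "0 < \<rho>" "\<rho> \<le> 1 / 2"
  defines "p \<equiv> exp (- \<epsilon>)"
  assumes large: "2 * p / (1 - p)\<^sup>2 < (real n)\<^sup>2 / 4"
  obtains m :: nat where "m \<ge> 1" "2 * p ^ m / (1 - p) \<le> 1"
    "real n * (2 * p ^ m / (1 - p) * ((real m)\<^sup>2 + 1)) + (real n * (2 * p ^ m / (1 - p)))\<^sup>2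
       \<le> \<rho> * (2 * p / (1 - p)\<^sup>2)"
    "4 * real m \<le> 4 * (14 + 10 * c) * (ln (real n / \<rho>) / (\<epsilon> * \<rho>))"
proof -
  define s where "s = real n / \<rho>"
  define L where "L = ln s"
  \<comment> \<open>Since \<open>L \<ge> 1 / 2\<close>, half of \<open>M * L\<close> is at least
    \<open>7 * L + 2 * c\<close>, the exponent needed for \<open>h\<close> below.\<close>
  define M where "M = 14 + 8 * c"
  define m where "m = nat \<lceil>M * L / \<epsilon>\<rceil>"
  define x where "x = \<epsilon> * real m"
  define h where "h = exp (- (x / 2))"
  define u where "u = 1 - p"
  have ns: "real n = s * \<rho>" using \<rho> by (simp add: s_def)
  have "2 * real n \<le> s" using \<rho> n by (simp add: s_def field_simps)
  with n have s: "s \<ge> 2" "real n \<le> s" by linarith+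
  have L: "L \<ge> 1 / 2" "exp L = s"
  proof -
    have "ln 2 \<le> L" unfolding L_def using s by simp
    then show "L \<ge> 1 / 2" using ln2_ge_two_thirds by linarith
    show "exp L = s" using s by (simp add: L_def)
  qed
  have "M * L / \<epsilon> > 0" using L c \<epsilon> by (simp add: M_def)
  then have m: "real m \<ge> M * L / \<epsilon>" "real m \<le> M * L / \<epsilon> + 1" "m \<ge> 1"
    unfolding m_def by linarith+
  have x: "x \<ge> M * L" "x \<ge> 0" using m(1) \<epsilon> by (auto simp: x_def field_simps)
  have P: "p ^ m = exp (- x)" by (simp add: p_def x_def exp_of_nat_mult[symmetric] mult.commute)
  have p: "exp (- c) \<le> p" "0 < p" "p < 1" using \<epsilon> by (auto simp: p_def)
  have u: "0 < u" "u \<le> \<epsilon>" "\<epsilon> * exp (- c) \<le> u"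
  proof -
    show "0 < u" using p by (simp add: u_def)
    show "u \<le> \<epsilon>" using exp_ge_add_one_self[of "- \<epsilon>"] by (simp add: u_def p_def)
    have "p * (1 + \<epsilon>) \<le> p * exp \<epsilon>"
      using p exp_ge_add_one_self[of \<epsilon>] by (intro mult_left_mono) auto
    also have "p * exp \<epsilon> = 1" by (simp add: p_def exp_minus)
    finally have "\<epsilon> * p \<le> u" by (simp add: u_def algebra_simps)
    moreover have "\<epsilon> * exp (- c) \<le> \<epsilon> * p" using p \<epsilon> by (intro mult_left_mono) auto
    ultimately show "\<epsilon> * exp (- c) \<le> u" by linarith
  qed
  have n\<epsilon>: "1 \<le> exp c * real n * \<epsilon>"
  proof -
    have "8 * p < (real n * u)\<^sup>2"
      using large u by (simp add: u_def[symmetric] field_simps power_mult_distrib)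
    moreover have "p\<^sup>2 \<le> p" using p by (simp add: power2_eq_square mult_left_le)
    ultimately have "p\<^sup>2 \<le> (real n * u)\<^sup>2" using p by linarith
    then have "p \<le> real n * u" by (rule power2_le_imp_le) (use u in auto)
    also have "\<dots> \<le> real n * \<epsilon>" using u by (intro mult_left_mono) auto
    finally have "exp (- c) \<le> real n * \<epsilon>" using p by linarith
    then show ?thesis by (simp add: exp_minus field_simps)
  qed
  have h: "32 * exp (2 * c) * s\<^sup>2 * h \<le> 1" "0 < h"
  proof -
    have "c * (1 / 2) \<le> c * L" using c L by (intro mult_left_mono) auto
    moreover have "M * L = 14 * L + 8 * (c * L)" by (simp add: M_def algebra_simps)
    ultimately have *: "2 * c + 7 * L \<le> x / 2" using x(1) by linarith
    \<comment> \<open>The constant 32 is paid by \<open>s ^ 5\<close>; with the factor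
      \<open>s\<^sup>2\<close> this accounts for the 7 in \<open>7 * L\<close>.\<close>
    have "(32::real) = 2 ^ 5" by simp
    also have "\<dots> \<le> s ^ 5" by (intro power_mono s) simp
    finally have "32 * exp (2 * c) * s\<^sup>2 * h \<le> s ^ 5 * exp (2 * c) * s\<^sup>2 * h"
      by (intro mult_right_mono) (auto simp: h_def)
    also have "\<dots> = exp (2 * c) * s ^ 7 * h" by (simp add: power_add[symmetric] ac_simps eval_nat_numeral)
    also have "\<dots> = exp (2 * c + 7 * L - x / 2)"
      unfolding h_def L(2)[symmetric] by (simp add: exp_of_nat_mult[symmetric] exp_add[symmetric])
    also have "\<dots> \<le> 1" using * by simp
    finally show "32 * exp (2 * c) * s\<^sup>2 * h \<le> 1" .
    show "0 < h" by (simp add: h_def)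
  qed
  have e2: "exp (2 * c) = exp c * exp c" by (simp add: exp_add[symmetric])
  have Ph: "p ^ m \<le> h" using x by (simp add: P h_def)
  have \<rho>2: "\<rho>\<^sup>2 \<le> \<rho>" using \<rho> by (simp add: power2_eq_square mult_left_le)
  \<comment> \<open>The common source of \<open>i\<close> and \<open>ii\<close>, whose target
    \<open>\<rho> * p\<close> is at least \<open>\<rho> * exp (- c)\<close>.\<close>
  have small: "32 * (real n)\<^sup>2 * exp c * h \<le> \<rho> * exp (- c)"
  proof -
    have "32 * (real n)\<^sup>2 * exp c * h = (\<rho>\<^sup>2 * exp (- c)) * (32 * exp (2 * c) * s\<^sup>2 * h)"
      unfolding ns e2 by (simp add: power_mult_distrib exp_minus field_simps)
    also have "\<dots> \<le> (\<rho>\<^sup>2 * exp (- c)) * 1" by (intro mult_left_mono h) auto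
    also have "\<dots> \<le> \<rho> * exp (- c)" using \<rho>2 by simp
    finally show ?thesis .
  qed
  have i: "4 * real n * p ^ m * (real m)\<^sup>2 * u \<le> \<rho> * p"
  proof -
    \<comment> \<open>The explicit factor 1 is next replaced by
      \<open>exp c * n * \<epsilon>\<close>, which supplies the second \<open>\<epsilon>\<close>
      needed to complete \<open>x\<^sup>2\<close>.\<close>
    have "4 * real n * p ^ m * (real m)\<^sup>2 * u \<le> 4 * real n * p ^ m * (real m)\<^sup>2 * \<epsilon> * 1"
      unfolding mult_1_right using u p by (intro mult_left_mono) auto
    also have "\<dots> \<le> 4 * real n * p ^ m * (real m)\<^sup>2 * \<epsilon> * (exp c * real n * \<epsilon>)"
      using p \<epsilon> by (intro mult_left_mono n\<epsilon>) auto
    also have "\<dots> = 4 * (real n)\<^sup>2 * exp c * (x\<^sup>2 * exp (- x))"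
      unfolding P by (simp add: x_def power2_eq_square ac_simps)
    also have "\<dots> \<le> 4 * (real n)\<^sup>2 * exp c * (8 * h)"
      unfolding h_def by (intro mult_left_mono square_times_exp_le x) auto
    also have "\<dots> \<le> \<rho> * exp (- c)" using small by simp
    also have "\<dots> \<le> \<rho> * p" using p \<rho> by simp
    finally show ?thesis .
  qed
  have ii: "4 * (real n)\<^sup>2 * (p ^ m)\<^sup>2 \<le> \<rho> * p"
  proof -
    have "p ^ m \<le> 1" using p by (simp add: power_le_one)
    then have "(p ^ m)\<^sup>2 \<le> 1 * h"
      unfolding power2_eq_square using Ph p by (intro mult_mono) auto
    then have "4 * (real n)\<^sup>2 * (p ^ m)\<^sup>2 \<le> 4 * (real n)\<^sup>2 * h" by (simp add: mult_left_mono)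
    also have "\<dots> \<le> (32 * exp c) * ((real n)\<^sup>2 * h)"
    proof -
      have "4 \<le> 32 * exp c" using one_le_exp_iff[of c] c by linarith
      then have "4 * ((real n)\<^sup>2 * h) \<le> (32 * exp c) * ((real n)\<^sup>2 * h)"
        using h by (intro mult_right_mono) auto
      then show ?thesis by (simp add: mult.assoc)
    qed
    also have "\<dots> \<le> \<rho> * exp (- c)" using small by (simp add: ac_simps)
    also have "\<dots> \<le> \<rho> * p" using p \<rho> by simp
    finally show ?thesis .
  qed
  have iii: "2 * p ^ m \<le> u"
  proof -
    have "2 * (p ^ m * (exp (2 * c) * real n)) \<le> 32 * (h * (exp (2 * c) * s\<^sup>2))"
    proof -
      have "real n \<le> s\<^sup>2" using s by (simp add: power2_eq_square) (smt (verit) mult_le_cancel_right1)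
      then have "p ^ m * (exp (2 * c) * real n) \<le> h * (exp (2 * c) * s\<^sup>2)"
        using Ph p h by (intro mult_mono mult_left_mono) auto
      moreover have "0 \<le> h * (exp (2 * c) * s\<^sup>2)" using h by simp
      ultimately show ?thesis by linarith
    qed
    also have "\<dots> \<le> 1" using h by (simp add: ac_simps)
    finally have "2 * p ^ m \<le> 1 / (exp (2 * c) * real n)" using n by (simp add: field_simps)
    also have "\<dots> \<le> \<epsilon> * exp (- c)"
      using n\<epsilon> n unfolding e2 by (simp add: field_simps exp_minus)
    also have "\<dots> \<le> u" by (rule u)
    finally show ?thesis .
  qed
  have m2: "(real m)\<^sup>2 + 1 \<le> 2 * (real m)\<^sup>2" using m(3) by simp
  show thesis
  proof (rule that[of m, folded u_def s_def])
    show "m \<ge> 1" by (rule m)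
    show "2 * p ^ m / u \<le> 1" using iii u by simp
    have "real n * (2 * p ^ m / u * ((real m)\<^sup>2 + 1)) \<le> real n * (2 * p ^ m / u * (2 * (real m)\<^sup>2))"
      using p u by (intro mult_left_mono m2) auto
    also have "\<dots> = (4 * real n * p ^ m * (real m)\<^sup>2 * u) / u\<^sup>2"
      using u by (simp add: power2_eq_square field_simps)
    also have "\<dots> \<le> \<rho> * p / u\<^sup>2" by (intro divide_right_mono i) auto
    finally have 1: "real n * (2 * p ^ m / u * ((real m)\<^sup>2 + 1)) \<le> \<rho> * p / u\<^sup>2" .
    have "(real n * (2 * p ^ m / u))\<^sup>2 = (4 * (real n)\<^sup>2 * (p ^ m)\<^sup>2) / u\<^sup>2"
      by (simp add: power_mult_distrib power_divide)
    also have "\<dots> \<le> \<rho> * p / u\<^sup>2" by (intro divide_right_mono ii) auto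
    finally have 2: "(real n * (2 * p ^ m / u))\<^sup>2 \<le> \<rho> * p / u\<^sup>2" .
    \<comment> \<open>The coin variance and the squared bias each use half of the allowed
      excess.\<close>
    have "\<rho> * (2 * p / u\<^sup>2) = \<rho> * p / u\<^sup>2 + \<rho> * p / u\<^sup>2" by simp
    with 1 2 show "real n * (2 * p ^ m / u * ((real m)\<^sup>2 + 1)) + (real n * (2 * p ^ m / u))\<^sup>2
        \<le> \<rho> * (2 * p / u\<^sup>2)" by linarith
    \<comment> \<open>Rounding up in \<open>m\<close> costs at most 1, which
      \<open>2 * c * L / \<epsilon>\<close> absorbs; this turns \<open>14 + 8 * c\<close> into
      \<open>14 + 10 * c\<close>.\<close>
    have "\<epsilon> \<le> 2 * c * L"
    proof -
      have "c * (1 / 2) \<le> c * L" using c L by (intro mult_left_mono) auto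
      then show ?thesis using \<epsilon> by linarith
    qed
    then have "1 \<le> 2 * c * L / \<epsilon>" using \<epsilon> by simp
    moreover have "M * L / \<epsilon> + 2 * c * L / \<epsilon> = (14 + 10 * c) * (L / \<epsilon>)"
      unfolding add_divide_distrib[symmetric] times_divide_eq_right
      by (simp add: M_def algebra_simps)
    ultimately have "real m \<le> (14 + 10 * c) * (L / \<epsilon>)" using m(2) by linarith
    also have "\<dots> \<le> (14 + 10 * c) * (L / (\<epsilon> * \<rho>))"
    proof -
      have "\<epsilon> * \<rho> \<le> \<epsilon>" using \<rho> \<epsilon> by (simp add: mult_left_le)
      then show ?thesis using L c \<epsilon> \<rho> by (intro mult_left_mono divide_left_mono) auto
    qed
    finally show "4 * real m \<le> 4 * (14 + 10 * c) * (ln s / (\<epsilon> * \<rho>))"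
      unfolding L_def mult.assoc by (rule mult_left_mono) simp
  qed
qed

section \<open>Combining the two protocols\<close>

theorem theorem6:
  "\<forall>c::real. c > 0 \<longrightarrow> (\<exists>C::real. C > 0 \<and>
     (\<forall>(n::nat) (\<epsilon>::real) (\<rho>::real).
        n \<ge> 1 \<longrightarrow> 0 < \<epsilon> \<longrightarrow> \<epsilon> \<le> c \<longrightarrow> 0 < \<rho> \<longrightarrow> \<rho> \<le> 1 / 2 \<longrightarrow>
        (\<exists>(R :: bool \<Rightarrow> bool multiset pmf) (A :: bool list \<Rightarrow> real).
           DP_shuffle n \<epsilon> R \<and>
           (\<forall>D. length D = n \<longrightarrow>
              summation_MSE R A D
                \<le> ennreal ((1 + \<rho>) * (2 * exp (- \<epsilon>) / (1 - exp (- \<epsilon>))\<^sup>2))) \<and>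
           (\<forall>x. expected_messages R x
                \<le> ennreal (C * (ln (real n / \<rho>) / (\<epsilon> * \<rho>)))))))"
proof (intro allI impI)
  fix c :: real assume c: "c > 0"
  show "\<exists>C::real. C > 0 \<and>
     (\<forall>(n::nat) (\<epsilon>::real) (\<rho>::real).
        n \<ge> 1 \<longrightarrow> 0 < \<epsilon> \<longrightarrow> \<epsilon> \<le> c \<longrightarrow> 0 < \<rho> \<longrightarrow> \<rho> \<le> 1 / 2 \<longrightarrow>
        (\<exists>(R :: bool \<Rightarrow> bool multiset pmf) (A :: bool list \<Rightarrow> real).
           DP_shuffle n \<epsilon> R \<and>
           (\<forall>D. length D = n \<longrightarrow>
              summation_MSE R A D
                \<le> ennreal ((1 + \<rho>) * (2 * exp (- \<epsilon>) / (1 - exp (- \<epsilon>))\<^sup>2))) \<and>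
           (\<forall>x. expected_messages R x
                \<le> ennreal (C * (ln (real n / \<rho>) / (\<epsilon> * \<rho>))))))"
  proof (intro exI[of _ "4 * (14 + 10 * c)"] conjI allI impI)
    show "0 < 4 * (14 + 10 * c)" using c by simp
    fix n :: nat and \<epsilon> \<rho> :: real
    assume *: "n \<ge> 1" "0 < \<epsilon>" "\<epsilon> \<le> c" "0 < \<rho>" "\<rho> \<le> 1 / 2"
    define p where "p = exp (- \<epsilon>)"
    have V: "2 * p / (1 - p)\<^sup>2 \<le> (1 + \<rho>) * (2 * p / (1 - p)\<^sup>2)"
      using * mult_right_mono[of 1 "1 + \<rho>" "2 * p / (1 - p)\<^sup>2"] by (simp add: p_def)
    show "\<exists>(R :: bool \<Rightarrow> bool multiset pmf) (A :: bool list \<Rightarrow> real).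
           DP_shuffle n \<epsilon> R \<and>
           (\<forall>D. length D = n \<longrightarrow>
              summation_MSE R A D
                \<le> ennreal ((1 + \<rho>) * (2 * exp (- \<epsilon>) / (1 - exp (- \<epsilon>))\<^sup>2))) \<and>
           (\<forall>x. expected_messages R x
                \<le> ennreal (4 * (14 + 10 * c) * (ln (real n / \<rho>) / (\<epsilon> * \<rho>))))"
    \<comment> \<open>The threshold compares the discrete Laplace variance with the error bound
      \<open>n\<^sup>2 / 4\<close> of the silent protocol.\<close>
    proof (cases "2 * p / (1 - p)\<^sup>2 < (real n)\<^sup>2 / 4")
      case True
      obtain m :: nat where m: "m \<ge> 1" "2 * p ^ m / (1 - p) \<le> 1"
        "real n * (2 * p ^ m / (1 - p) * ((real m)\<^sup>2 + 1)) + (real n * (2 * p ^ m / (1 - p)))\<^sup>2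
           \<le> \<rho> * (2 * p / (1 - p)\<^sup>2)"
        "4 * real m \<le> 4 * (14 + 10 * c) * (ln (real n / \<rho>) / (\<epsilon> * \<rho>))"
        using parameter_bounds[OF c *] True unfolding p_def by metis
      have mse: "2 * p / (1 - p)\<^sup>2 + real n * (2 * p ^ m / (1 - p) * ((real m)\<^sup>2 + 1)) +
          (real n * (2 * p ^ m / (1 - p)))\<^sup>2 \<le> (1 + \<rho>) * (2 * p / (1 - p)\<^sup>2)"
        using m(3) distrib_right[of 1 \<rho> "2 * p / (1 - p)\<^sup>2"] by linarith
      show ?thesis
        using unary_protocol[OF *(1) m(1) *(2) m(2)[unfolded p_def]]
          order_trans[OF _ ennreal_leI[OF mse]] order_trans[OF _ ennreal_leI[OF m(4)]]
        unfolding p_def by meson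
    next
      case False
      then have "(real n)\<^sup>2 / 4 \<le> (1 + \<rho>) * (2 * p / (1 - p)\<^sup>2)" using V by linarith
      then show ?thesis
        using silent_protocol[of \<epsilon> n] *(2) order_trans[OF _ ennreal_leI]
          order_trans[OF _ zero_le] unfolding p_def by (meson less_imp_le)
    qed
  qed
qed

end
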